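(* Let $V=(V,+,\circ,K)$ be a strongly right distributive hypervector space over a field $K$, and let $(F,A)$ be a bipolar fuzzy soft hypervector space of $V$. Then $(a\circ F,A)$ is a bipolar fuzzy soft hypervector space of $V$ for all $a\in K$.
   Context: Hypervector space: let $K$ be a field, $(V,+)$ an Abelian group, $P_*(V)$ the set of non-empty subsets of $V$. A hypervector space over $K$ is a quadruple $(V,+,\circ,K)$ with an external hyperoperation $\circ:K\times V\to P_*(V)$ such that for all $a,b\in K$, $x,y\in V$: (i) $a\circ(x+y)\subseteq a\circ x+a\circ y$; (ii) $(a+b)\circ x\subseteq a\circ x+b\circ x$; (iii) $a\circ(b\circ x)=(ab)\circ x$; (iv) $a\circ(-x)=(-a)\circ x=-(a\circ x)$; (v) $x\in 1\circ x$. Here, for subsets, $S+T=\{p+q: p\in S,q\in T\}$, $-S=\{-s:s\in S\}$, and $a\circ(b\circ x)=\bigcup_{t\in b\circ x}a\circ t$. $V$ is strongly right distributive if equality holds in (i) for all $a\in K$, $x,y\in V$. Bipolar fuzzy soft set: let $E$ be a set of parameters and $A\subseteq E$. A bipolar fuzzy soft set $(F,A)$ over $V$ assigns to each $e\in A$ a pair of functions $F_e^+:V\to[0,1]$ and $F_e^-:V\to[-1,0]$. Bipolar fuzzy soft hypervector space: $(F,A)$ is a bipolar fuzzy soft hypervector space of $V$ if for all $e\in A$, $x,y\in V$, $a\in K$: (1) $F_e^+(x-y)\ge F_e^+(x)\wedge F_e^+(y)$ and $F_e^-(x-y)\le F_e^-(x)\vee F_e^-(y)$; (2) $\bigwedge_{t\in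 a\circ x}F_e^+(t)\ge F_e^+(x)$ and $\bigvee_{t\in a\circ x}F_e^-(t)\le F_e^-(x)$. Here $\wedge,\vee$ (and $\bigwedge,\bigvee$) denote minimum and maximum (infimum and supremum) of real numbers. Scalar product: for $a\in K$, $a\circ(F,A)=(a\circ F,A)$ is the bipolar fuzzy soft set where, for $e\in A$, $x\in V$: if there exists $t\in V$ with $x\in a\circ t$, then $(a\circ F)^+_e(x)=\bigvee_{t\in V,\,x\in a\circ t}F^+_e(t)$ and $(a\circ F)^-_e(x)=\bigwedge_{t\in V,\,x\in a\circ t}F^-_e(t)$; otherwise $(a\circ F)^+_e(x)=(a\circ F)^-_e(x)=0$. *)

theory Defs
  imports Complex_Main "HOL-Library.Set_Algebras"
begin

text \<open>The field \<open>K\<close> and the Abelian group \<open>V\<close> are the types \<open>'k\<close> and \<open>'v\<close>. Sums of subsets are those of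
  Set_Algebras; \<open>-S\<close> is written as an image, since unary minus on sets denotes the complement.\<close>

locale hypervector_space =
  fixes hmult :: "'k::field \<Rightarrow> 'v::ab_group_add \<Rightarrow> 'v set"  (infixr "\<odot>" 75)
  assumes hmult_nonempty: "a \<odot> x \<noteq> {}"
    and hmult_add_right: "a \<odot> (x + y) \<subseteq> a \<odot> x + a \<odot> y"
    and hmult_add_left: "(a + b) \<odot> x \<subseteq> a \<odot> x + b \<odot> x"
    and hmult_assoc: "(\<Union>t\<in>b \<odot> x. a \<odot> t) = (a * b) \<odot> x"
    and hmult_minus_right: "a \<odot> (- x) = (- a) \<odot> x"
    and hmult_minus_left: "(- a) \<odot> x = uminus ` (a \<odot> x)"
    and hmult_one: "x \<in> 1 \<odot> x"

locale strongly_right_distributive_hypervector_space = hypervector_space +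
  assumes hmult_add_right_eq: "a \<odot> (x + y) = a \<odot> x + a \<odot> y"

text \<open>A bipolar fuzzy soft set \<open>(F, A)\<close> is given by a parameter set \<open>A\<close> and a function \<open>F\<close> with
  \<open>F e = (F\<^sub>e\<^sup>+, F\<^sub>e\<^sup>-)\<close>; the values of \<open>F\<close> outside \<open>A\<close> are irrelevant. The ambient
  parameter set \<open>E\<close> is the type \<open>'e\<close>.\<close>

type_synonym ('e, 'v) bipolar_family = "'e \<Rightarrow> ('v \<Rightarrow> real) \<times> ('v \<Rightarrow> real)"

abbreviation pos_part :: "('e, 'v) bipolar_family \<Rightarrow> 'e \<Rightarrow> 'v \<Rightarrow> real" where
  "pos_part F e \<equiv> fst (F e)"

abbreviation neg_part :: "('e, 'v) bipolar_family \<Rightarrow> 'e \<Rightarrow> 'v \<Rightarrow> real" where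
  "neg_part F e \<equiv> snd (F e)"

definition bipolar_fuzzy_soft_set :: "('e, 'v) bipolar_family \<Rightarrow> 'e set \<Rightarrow> bool" where
  "bipolar_fuzzy_soft_set F A \<longleftrightarrow>
     (\<forall>e\<in>A. \<forall>x. pos_part F e x \<in> {0..1} \<and> neg_part F e x \<in> {-1..0})"

text \<open>The infima and suprema below are taken in the reals; they are genuine, since in a hypervector space
  the sets \<open>hmult a x\<close> are non-empty and the values of a bipolar fuzzy soft set are bounded.\<close>

definition bipolar_fuzzy_soft_hypervector_space ::
  "('k::field \<Rightarrow> 'v::ab_group_add \<Rightarrow> 'v set) \<Rightarrow> ('e, 'v) bipolar_family \<Rightarrow> 'e set \<Rightarrow> bool" where
  "bipolar_fuzzy_soft_hypervector_space hmult F A \<longleftrightarrow>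
     bipolar_fuzzy_soft_set F A \<and>
     (\<forall>e\<in>A. \<forall>x y.
        pos_part F e (x - y) \<ge> min (pos_part F e x) (pos_part F e y) \<and>
        neg_part F e (x - y) \<le> max (neg_part F e x) (neg_part F e y)) \<and>
     (\<forall>e\<in>A. \<forall>a x.
        (INF t\<in>hmult a x. pos_part F e t) \<ge> pos_part F e x \<and>
        (SUP t\<in>hmult a x. neg_part F e t) \<le> neg_part F e x)"

definition scalar_product ::
  "('k \<Rightarrow> 'v \<Rightarrow> 'v set) \<Rightarrow> 'k \<Rightarrow> ('e, 'v) bipolar_family \<Rightarrow> ('e, 'v) bipolar_family" where
  "scalar_product hmult a F = (\<lambda>e.
     (\<lambda>x. if \<exists>t. x \<in> hmult a t then SUP t\<in>{t. x \<in> hmult a t}. pos_part F e t else 0,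
      \<lambda>x. if \<exists>t. x \<in> hmult a t then INF t\<in>{t. x \<in> hmult a t}. neg_part F e t else 0))"

end

theory Submission
  imports Defs
begin

text \<open>Negation turns the negative part of a bipolar fuzzy set into a positive one, and suprema into
  infima, so it suffices to treat a single function \<open>f : V \<rightarrow> [0,1]\<close>. If \<open>x \<in> a \<circ> s\<close> and \<open>y \<in> a \<circ> t\<close>,
  then strong distributivity gives \<open>x - y \<in> a \<circ> (s - t)\<close>; and if \<open>x \<in> a \<circ> s\<close> and \<open>z \<in> b \<circ> x\<close>, then
  commutativity of \<open>K\<close> gives \<open>z \<in> (ba) \<circ> s = a \<circ> (b \<circ> s)\<close>. Both inequalities for \<open>a \<circ> f\<close> thus follow
  from those for \<open>f\<close>, and they are trivial at points outside all \<open>a \<circ> t\<close>, where \<open>a \<circ> f\<close> takes its least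
  value \<open>0\<close>.\<close>

text \<open>The last clause bounds each value instead of an infimum; the two agree for bounded
  \<open>f\<close> and non-empty \<open>hmult a x\<close>.\<close>

definition fuzzy_subspace :: "('k \<Rightarrow> 'v::ab_group_add \<Rightarrow> 'v set) \<Rightarrow> ('v \<Rightarrow> real) \<Rightarrow> bool" where
  "fuzzy_subspace hmult f \<longleftrightarrow>
     (\<forall>x. f x \<in> {0..1}) \<and>
     (\<forall>x y. min (f x) (f y) \<le> f (x - y)) \<and>
     (\<forall>a x. \<forall>t\<in>hmult a x. f x \<le> f t)"

definition fuzzy_scale :: "('k \<Rightarrow> 'v \<Rightarrow> 'v set) \<Rightarrow> 'k \<Rightarrow> ('v \<Rightarrow> real) \<Rightarrow> 'v \<Rightarrow> real" where
  "fuzzy_scale hmult a f x =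
     (if \<exists>t. x \<in> hmult a t then SUP t\<in>{t. x \<in> hmult a t}. f t else 0)"

lemma pos_part_scalar_product:
  "pos_part (scalar_product hmult a F) e = fuzzy_scale hmult a (pos_part F e)"
  by (simp add: scalar_product_def fuzzy_scale_def fun_eq_iff)

text \<open>A real infimum is by definition the negated supremum of the negated set, and the default
  value 0 is its own negative.\<close>

lemma neg_part_scalar_product:
  "- neg_part (scalar_product hmult a F) e = fuzzy_scale hmult a (- neg_part F e)"
  by (simp add: scalar_product_def fuzzy_scale_def fun_eq_iff Inf_real_def image_image)

lemma fuzzy_scale_upper:
  assumes "\<And>x. f x \<in> {0..1}" and "x \<in> hmult a t"
  shows "f t \<le> fuzzy_scale hmult a f x"
proof -
  have "bdd_above (f ` {t. x \<in> hmult a t})"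
    using assms(1) by (auto intro!: bdd_aboveI[of _ 1])
  then show ?thesis
    using assms(2) by (auto simp: fuzzy_scale_def intro!: cSUP_upper)
qed

lemma fuzzy_scale_least:
  assumes "\<And>t. x \<in> hmult a t \<Longrightarrow> f t \<le> c" and "0 \<le> c"
  shows "fuzzy_scale hmult a f x \<le> c"
  using assms by (auto simp: fuzzy_scale_def intro!: cSUP_least)

text \<open>The supremum need not be attained, but any number strictly below it is exceeded at some
  \<open>t\<close>; \<open>0 \<le> c\<close> rules out the default value 0.\<close>

lemma less_fuzzy_scaleE:
  assumes "c < fuzzy_scale hmult a f x" and "0 \<le> c"
  obtains t where "x \<in> hmult a t" and "c < f t"
  using fuzzy_scale_least[of x hmult a f c] assms by force

lemma fuzzy_scale_bounds:
  assumes "\<And>x. f x \<in> {0..1}"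
  shows "fuzzy_scale hmult a f x \<in> {0..1}"
proof -
  have "0 \<le> fuzzy_scale hmult a f x"
  proof (cases "\<exists>t. x \<in> hmult a t")
    case True
    then obtain t where "x \<in> hmult a t" ..
    then have "f t \<le> fuzzy_scale hmult a f x"
      using assms by (intro fuzzy_scale_upper)
    moreover have "0 \<le> f t"
      using assms[of t] by simp
    ultimately show ?thesis by linarith
  qed (simp add: fuzzy_scale_def)
  moreover have "fuzzy_scale hmult a f x \<le> 1"
    using assms by (intro fuzzy_scale_least) auto
  ultimately show ?thesis by simp
qed

context hypervector_space
begin

lemma bipolar_fuzzy_soft_hypervector_space_iff:
  "bipolar_fuzzy_soft_hypervector_space hmult F A \<longleftrightarrow>
     (\<forall>e\<in>A. fuzzy_subspace hmult (pos_part F e) \<and> fuzzy_subspace hmult (- neg_part F e))"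
proof -
  have INF: "c \<le> (INF t\<in>a \<odot> x. p t) \<longleftrightarrow> (\<forall>t\<in>a \<odot> x. c \<le> p t)"
    if "\<And>t. p t \<in> {0..1}" for p :: "'v \<Rightarrow> real" and c a x
    using that hmult_nonempty by (intro le_cINF_iff bdd_belowI[of _ 0]) auto
  have SUP: "(SUP t\<in>a \<odot> x. n t) \<le> c \<longleftrightarrow> (\<forall>t\<in>a \<odot> x. n t \<le> c)"
    if "\<And>t. n t \<in> {-1..0}" for n :: "'v \<Rightarrow> real" and c a x
    using that hmult_nonempty by (intro cSUP_le_iff bdd_aboveI[of _ 0]) auto
  have neg_bounds: "- r \<in> {0..1} \<longleftrightarrow> r \<in> {-1..0}" for r :: real
    by auto
  have neg_min: "min (- r) (- s) \<le> - t \<longleftrightarrow> t \<le> max r s" for r s t :: real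
    by linarith
  have "((\<forall>x. p x \<in> {0..1} \<and> n x \<in> {-1..0}) \<and>
      (\<forall>x y. min (p x) (p y) \<le> p (x - y) \<and> n (x - y) \<le> max (n x) (n y)) \<and>
      (\<forall>a x. p x \<le> (INF t\<in>a \<odot> x. p t) \<and> (SUP t\<in>a \<odot> x. n t) \<le> n x)) \<longleftrightarrow>
    fuzzy_subspace hmult p \<and> fuzzy_subspace hmult (- n)" (is "?L \<longleftrightarrow> ?R")
    for p n :: "'v \<Rightarrow> real"
  \<comment> \<open>The equivalences \<open>INF\<close> and \<open>SUP\<close> are available only
    under the bounds; where these fail, both sides are false.\<close>
  proof (cases "\<forall>x. p x \<in> {0..1} \<and> n x \<in> {-1..0}")
    case True
    then have "\<And>x. p x \<in> {0..1}" and "\<And>x. n x \<in> {-1..0}"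
      by blast+
    note eqs = INF[OF this(1)] SUP[OF this(2)]
    show ?thesis
      using True
      unfolding fuzzy_subspace_def eqs fun_Compl_def neg_bounds neg_min neg_le_iff_le by blast
  next
    case False
    then show ?thesis
      unfolding fuzzy_subspace_def fun_Compl_def neg_bounds by blast
  qed
  note pointwise = this[symmetric]
  show ?thesis
    unfolding bipolar_fuzzy_soft_hypervector_space_def bipolar_fuzzy_soft_set_def pointwise
    by blast
qed

lemma hmult_commute:
  assumes "x \<in> a \<odot> s" and "z \<in> b \<odot> x"
  obtains u where "u \<in> b \<odot> s" and "z \<in> a \<odot> u"
proof -
  have "z \<in> (\<Union>t\<in>a \<odot> s. b \<odot> t)"
    using assms by blast
  also have "\<dots> = (\<Union>t\<in>b \<odot> s. a \<odot> t)"
    by (simp only: hmult_assoc mult.commute)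
  finally show thesis
    using that by blast
qed

end

context strongly_right_distributive_hypervector_space
begin

lemma diff_mem_hmult:
  assumes "x \<in> a \<odot> s" and "y \<in> a \<odot> t"
  shows "x - y \<in> a \<odot> (s - t)"
proof -
  \<comment> \<open>The sign moves from \<open>t\<close> to the scalar and from there to the
    set.\<close>
  have "- y \<in> a \<odot> (- t)"
    using assms(2) by (simp add: hmult_minus_right hmult_minus_left)
  then have "x + - y \<in> a \<odot> (s + - t)"
    unfolding hmult_add_right_eq using assms(1) by (rule set_plus_intro[rotated])
  then show ?thesis by simp
qed

lemma fuzzy_subspace_scale:
  assumes "fuzzy_subspace hmult f"
  shows "fuzzy_subspace hmult (fuzzy_scale hmult a f)"
proof -
  have bounds: "\<And>x. f x \<in> {0..1}"
    and diff: "\<And>x y. min (f x) (f y) \<le> f (x - y)"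
    and scale: "\<And>b x t. t \<in> b \<odot> x \<Longrightarrow> f x \<le> f t"
    using assms by (auto simp: fuzzy_subspace_def)
  let ?g = "fuzzy_scale hmult a f"
  have g_bounds: "?g x \<in> {0..1}" for x
    using bounds by (rule fuzzy_scale_bounds)
  have "min (?g x) (?g y) \<le> ?g (x - y)" for x y
  \<comment> \<open>Strictness replaces an epsilon argument: if \<open>?c\<close> lies below both
    suprema, some \<open>s\<close> and \<open>t\<close> have values above \<open>?c\<close>, whereas
    \<open>min (f s) (f t) \<le> f (s - t) \<le> ?c\<close>.\<close>
  proof (rule ccontr)
    let ?c = "?g (x - y)"
    assume "\<not> ?thesis"
    then have less: "?c < ?g x" "?c < ?g y"
      by auto
    have "0 \<le> ?c"
      using g_bounds[of "x - y"] by simp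
    obtain s where s: "x \<in> a \<odot> s" "?c < f s"
      using less(1) \<open>0 \<le> ?c\<close> by (rule less_fuzzy_scaleE)
    obtain t where t: "y \<in> a \<odot> t" "?c < f t"
      using less(2) \<open>0 \<le> ?c\<close> by (rule less_fuzzy_scaleE)
    have "f (s - t) \<le> ?c"
      using bounds diff_mem_hmult[OF s(1) t(1)] by (rule fuzzy_scale_upper)
    with s(2) t(2) diff[of s t] show False
      by linarith
  qed
  moreover have "?g x \<le> ?g z" if "z \<in> b \<odot> x" for b x z
  proof (rule fuzzy_scale_least)
    \<comment> \<open>Each \<open>s\<close> competing in the supremum at \<open>x\<close> is
      dominated by some \<open>u\<close> competing at \<open>z\<close>.\<close>
    fix s assume "x \<in> a \<odot> s"
    then obtain u where u: "u \<in> b \<odot> s" "z \<in> a \<odot> u"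
      using \<open>z \<in> b \<odot> x\<close> by (rule hmult_commute)
    have "f s \<le> f u"
      using u(1) by (rule scale)
    also have "\<dots> \<le> ?g z"
      using bounds u(2) by (rule fuzzy_scale_upper)
    finally show "f s \<le> ?g z" .
  next
    show "0 \<le> ?g z"
      using g_bounds[of z] by simp
  qed
  ultimately show ?thesis
    using g_bounds unfolding fuzzy_subspace_def by blast
qed

end

theorem proposition4p10:
  fixes hmult :: "'k::field \<Rightarrow> 'v::ab_group_add \<Rightarrow> 'v set"
    and F :: "('e, 'v) bipolar_family" and A :: "'e set"
  assumes "strongly_right_distributive_hypervector_space hmult"
    and "bipolar_fuzzy_soft_hypervector_space hmult F A"
  shows "\<forall>a :: 'k. bipolar_fuzzy_soft_hypervector_space hmult (scalar_product hmult a F) A"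
proof -
  interpret strongly_right_distributive_hypervector_space hmult
    by (rule assms(1))
  show ?thesis
    using assms(2) fuzzy_subspace_scale
    by (simp add: bipolar_fuzzy_soft_hypervector_space_iff pos_part_scalar_product
        neg_part_scalar_product)
qed

end
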